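(* Let $\alpha\in[0,1]$, let $n=2k-1$ for some $k\in\mathbb{N}$, $k\ge1$, let $s_{2i-1}=s_{2i}=\frac{2i-1}{2k}$ for $i\in\{1,\dots,k\}$, and let $\mathsf{s}_{\mathrm{pair}}=(s_1,\dots,s_{k-1},s_k,s_{k+2},\dots,s_{n+1})$ (i.e. the entry $s_{k+1}$ of $(s_1,\dots,s_{2k})$ is omitted). Let $\mathsf{f}$ be the induced client equilibrium. Then the quality of $(\mathsf{s}_{\mathrm{pair}},\mathsf{f})$ satisfies $$Q(\mathsf{s}_{\mathrm{pair}},\mathsf{f})\le\frac{8(1+\alpha)n^2}{(1+3\alpha)(1+n)^2}.$$
   Context: The game with parameters $n\ge 1$ and $\alpha\in[0,1]$: there are $n$ facility players $\{1,\dots,n\}$, each choosing a location $s_i\in[0,1]$; a facility location vector is $\mathsf{s}=(s_1,\dots,s_n)\in[0,1]^n$. The clients are the points $z\in[0,1]$. A client mapping is a function $\mathsf{f}:[0,1]^n\times[0,1]\to\{1,\dots,n\}$; client $z$ uses facility $\mathsf{f}(\mathsf{s},z)$. Only measurable mappings are considered: for every $\mathsf{s}$ and $i$, the set $\{z:\mathsf{f}(\mathsf{s},z)=i\}$ is a finite union of disjoint intervals; its total length is the load $\ell_i(\mathsf{s},\mathsf{f})$. The cost of client $z$ is $C_z(\mathsf{s},\mathsf{f})=(1-\alpha)|s_{\mathsf{f}(\mathsf{s},z)}-z|+\alpha\,\ell_{\mathsf{f}(\mathsf{s},z)}(\mathsf{s},\mathsf{f})$. $\mathsf{f}(\mathsf{s},\cdot)$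 is a client equilibrium if for all $z\in[0,1]$ and all $j$, $(1-\alpha)|s_{\mathsf{f}(\mathsf{s},z)}-z|+\alpha\ell_{\mathsf{f}(\mathsf{s},z)}(\mathsf{s},\mathsf{f})\le(1-\alpha)|s_j-z|+\alpha\ell_j(\mathsf{s},\mathsf{f})$. With facilities named so that locations are non-decreasing in the index, it is proper if $[0,1]$ is partitioned (up to endpoints) into consecutive intervals $[\beta_{i-1},\beta_i]$, $\beta_0=0$, $\beta_n=1$, with facility $i$ serving $[\beta_{i-1},\beta_i]$. The induced client equilibrium is the (unique) proper client equilibrium; for $\alpha=0$, where clients are indifferent between co-located facilities, co-located facilities share equally the interval of clients nearest to their common location. Social cost: $SC(\mathsf{s},\mathsf{f})=\int_0^1 C_z(\mathsf{s},\mathsf{f})\,dz$. Social optimum: $\mathrm{opt}=\min_{(\mathsf{s},\mathsf{f})}SC(\mathsf{s},\mathsf{f})$ over all location vectors and (measurable) client mappings. Quality: $Q(\mathsf{s},\mathsf{f})=SC(\mathsf{s},\mathsf{f})/\mathrm{opt}$. *)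

theory Defs
  imports "HOL-Analysis.Analysis"
begin

text \<open>
  A vector in \<open>[0,1]\<^sup>n\<close> is a function on the index set \<open>{1..n}\<close> that is \<open>undefined\<close>
  outside it. A client mapping is constrained only on location vectors and on clients in
  \<open>[0,1]\<close>; its values elsewhere never matter.
\<close>

definition location_vectors :: "nat \<Rightarrow> (nat \<Rightarrow> real) set" where
  "location_vectors n = {1..n} \<rightarrow>\<^sub>E {0..1}"

definition clients_of :: "(nat \<Rightarrow> real) \<Rightarrow> ((nat \<Rightarrow> real) \<Rightarrow> real \<Rightarrow> nat) \<Rightarrow> nat \<Rightarrow> real set" where
  "clients_of s f i = {z \<in> {0..1}. f s z = i}"

definition finite_union_of_disjoint_intervals :: "real set \<Rightarrow> bool" where
  "finite_union_of_disjoint_intervals A \<longleftrightarrow>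
     (\<exists>\<I>. finite \<I> \<and> disjoint \<I> \<and> (\<forall>I\<in>\<I>. is_interval I) \<and> A = \<Union>\<I>)"

definition client_mapping :: "nat \<Rightarrow> ((nat \<Rightarrow> real) \<Rightarrow> real \<Rightarrow> nat) \<Rightarrow> bool" where
  "client_mapping n f \<longleftrightarrow> (\<forall>s \<in> location_vectors n. \<forall>z \<in> {0..1}. f s z \<in> {1..n})"

definition measurable_client_mapping :: "nat \<Rightarrow> ((nat \<Rightarrow> real) \<Rightarrow> real \<Rightarrow> nat) \<Rightarrow> bool" where
  "measurable_client_mapping n f \<longleftrightarrow> client_mapping n f \<and>
     (\<forall>s \<in> location_vectors n. \<forall>i \<in> {1..n}.
        finite_union_of_disjoint_intervals (clients_of s f i))"

definition load :: "(nat \<Rightarrow> real) \<Rightarrow> ((nat \<Rightarrow> real) \<Rightarrow> real \<Rightarrow> nat) \<Rightarrow> nat \<Rightarrow> real" where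
  "load s f i = measure lborel (clients_of s f i)"

definition client_cost ::
    "real \<Rightarrow> (nat \<Rightarrow> real) \<Rightarrow> ((nat \<Rightarrow> real) \<Rightarrow> real \<Rightarrow> nat) \<Rightarrow> real \<Rightarrow> real" where
  "client_cost \<alpha> s f z = (1 - \<alpha>) * \<bar>s (f s z) - z\<bar> + \<alpha> * load s f (f s z)"

definition client_equilibrium ::
    "real \<Rightarrow> nat \<Rightarrow> (nat \<Rightarrow> real) \<Rightarrow> ((nat \<Rightarrow> real) \<Rightarrow> real \<Rightarrow> nat) \<Rightarrow> bool" where
  "client_equilibrium \<alpha> n s f \<longleftrightarrow>
     (\<forall>z \<in> {0..1}. \<forall>j \<in> {1..n}.
        client_cost \<alpha> s f z \<le> (1 - \<alpha>) * \<bar>s j - z\<bar> + \<alpha> * load s f j)"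

text \<open>
  Facilities are assumed to be named in the order of their locations. The breakpoints
  \<open>\<beta> i\<close> themselves may be served by any facility, which is the meaning of
  ``partitioned up to endpoints''; intervals may be degenerate.
\<close>

definition proper ::
    "nat \<Rightarrow> (nat \<Rightarrow> real) \<Rightarrow> ((nat \<Rightarrow> real) \<Rightarrow> real \<Rightarrow> nat) \<Rightarrow> bool" where
  "proper n s f \<longleftrightarrow> mono_on {1..n} s \<and>
     (\<exists>\<beta> :: nat \<Rightarrow> real. \<beta> 0 = 0 \<and> \<beta> n = 1 \<and>
        (\<forall>i \<in> {1..n}. \<beta> (i - 1) \<le> \<beta> i \<and> (\<forall>z \<in> {\<beta> (i - 1)<..<\<beta> i}. f s z = i)))"

text \<open>
  For \<open>\<alpha> = 0\<close> the equilibrium condition only says that every client uses a nearest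
  facility, so a proper equilibrium may split the interval of a group of co-located
  facilities arbitrarily; the last conjunct selects the equal split.
\<close>

definition induced_client_equilibrium ::
    "real \<Rightarrow> nat \<Rightarrow> (nat \<Rightarrow> real) \<Rightarrow> ((nat \<Rightarrow> real) \<Rightarrow> real \<Rightarrow> nat) \<Rightarrow> bool" where
  "induced_client_equilibrium \<alpha> n s f \<longleftrightarrow>
     client_equilibrium \<alpha> n s f \<and> proper n s f \<and>
     (\<alpha> = 0 \<longrightarrow> (\<forall>i \<in> {1..n}. \<forall>j \<in> {1..n}. s i = s j \<longrightarrow> load s f i = load s f j))"

definition social_cost ::
    "real \<Rightarrow> (nat \<Rightarrow> real) \<Rightarrow> ((nat \<Rightarrow> real) \<Rightarrow> real \<Rightarrow> nat) \<Rightarrow> real" where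
  "social_cost \<alpha> s f = integral {0..1} (client_cost \<alpha> s f)"

text \<open>
  The minimum is attained (equidistant facilities \<open>(2i - 1)/(2n)\<close>, each serving its
  nearest clients), so the infimum below is the minimum.
\<close>

definition social_opt :: "real \<Rightarrow> nat \<Rightarrow> real" where
  "social_opt \<alpha> n =
     Inf {social_cost \<alpha> s f | s f. s \<in> location_vectors n \<and> measurable_client_mapping n f}"

definition quality ::
    "real \<Rightarrow> nat \<Rightarrow> (nat \<Rightarrow> real) \<Rightarrow> ((nat \<Rightarrow> real) \<Rightarrow> real \<Rightarrow> nat) \<Rightarrow> real" where
  "quality \<alpha> n s f = social_cost \<alpha> s f / social_opt \<alpha> n"

definition omit_entry :: "nat \<Rightarrow> nat \<Rightarrow> (nat \<Rightarrow> real) \<Rightarrow> nat \<Rightarrow> real" where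
  "omit_entry n m s = (\<lambda>j\<in>{1..n}. if j < m then s j else s (j + 1))"

end

theory Submission
  imports Defs
begin

text \<open>
  Upper bound: in equilibrium no client gains by moving, so let every client
  \<open>z \<in> [(m - 1)/k, m/k]\<close> consider facility \<open>2m - 1\<close>, which sits at the midpoint of that
  interval. The distances contribute \<open>1/(4k)\<close> and, as these facilities are distinct and the
  loads add up to 1, the loads contribute at most \<open>1/k\<close>; hence the social cost is at most
  \<open>(1 - \<alpha>)/(4k) + \<alpha>/k = (1 + 3\<alpha>)/(4k)\<close>.

  Lower bound on the optimum: with \<open>r = 1/(2n)\<close> every client pays a distance of at least
  \<open>r - (\<Sum>i. max 0 (r - \<bar>s i - z\<bar>))\<close>, which integrates to at least \<open>r - n r\<^sup>2 = 1/(4n)\<close>, and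
  the squares of the loads add up to at least \<open>1/n\<close>; hence the optimum is at least
  \<open>(1 + 3\<alpha>)/(4n)\<close>. The quality is therefore at most \<open>n/k = 2n/(n + 1)\<close>.
\<close>

section \<open>Measurability of client sets and integration over them\<close>

lemma borel_finite_union_of_disjoint_intervals:
  assumes "finite_union_of_disjoint_intervals A"
  shows "A \<in> sets borel"
proof -
  obtain I where "finite I" "\<forall>J\<in>I. is_interval J" "A = \<Union>I"
    using assms unfolding finite_union_of_disjoint_intervals_def by blast
  then show ?thesis
    using real_interval_borel_measurable by (auto intro: sets.finite_Union)
qed

lemma clients_of_borel:
  assumes "measurable_client_mapping n f" "s \<in> location_vectors n" "i \<in> {1..n}"
  shows "clients_of s f i \<in> sets borel"
  using assms borel_finite_union_of_disjoint_intervals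
  unfolding measurable_client_mapping_def by blast

lemma clients_of_subset: "clients_of s f i \<subseteq> {0..1}"
  by (auto simp: clients_of_def)

lemma integral_const_clients_of:
  assumes "measurable_client_mapping n f" "s \<in> location_vectors n" "i \<in> {1..n}"
  shows "integral (clients_of s f i) (\<lambda>_. c) = c * load s f i"
proof -
  have B: "clients_of s f i \<in> sets borel"
    using clients_of_borel assms by blast
  have "clients_of s f i \<in> lmeasurable"
    by (rule bounded_set_imp_lmeasurable)
      (use B bounded_subset[OF bounded_closed_interval clients_of_subset] in auto)
  then have "measure lebesgue (clients_of s f i) = integral (clients_of s f i) (\<lambda>_. 1)"
    by (rule lmeasure_integral)
  \<comment> \<open>\<open>load\<close> is a \<open>lborel\<close> measure; on a Borel set the
    completion does not change its value.\<close>
  moreover have "measure lebesgue (clients_of s f i) = load s f i"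
    unfolding load_def using B by (simp add: measure_completion)
  ultimately show ?thesis
    using integral_mult_right[of "clients_of s f i" c "\<lambda>_. 1"] by simp
qed

text \<open>The client sets split the integrand into \<open>n\<close> pieces, each integrable
  because it is continuous on a Borel subset of the unit interval. At each client exactly one piece
  survives, since \<open>f s z\<close> lies in \<open>{1..n}\<close>.\<close>

lemma has_integral_over_clients:
  fixes F :: "nat \<Rightarrow> real \<Rightarrow> real"
  assumes f: "measurable_client_mapping n f" and s: "s \<in> location_vectors n"
    and F: "\<And>i. i \<in> {1..n} \<Longrightarrow> continuous_on {0..1} (F i)"
  shows "((\<lambda>z. F (f s z) z) has_integral (\<Sum>i\<in>{1..n}. integral (clients_of s f i) (F i))) {0..1}"
proof -
  let ?g = "\<lambda>i z. if z \<in> clients_of s f i then F i z else 0"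
  have "(?g i has_integral integral (clients_of s f i) (F i)) {0..1}" if i: "i \<in> {1..n}" for i
  proof -
    have "F i absolutely_integrable_on clients_of s f i"
      by (rule set_integrable_subset[OF absolutely_integrable_continuous_real[OF F[OF i]] _
            clients_of_subset])
        (use clients_of_borel[OF f s i] in simp)
    then have "F i integrable_on clients_of s f i"
      by (rule set_lebesgue_integral_eq_integral)
    then show ?thesis
      by (simp only: has_integral_restrict[OF clients_of_subset] integrable_integral)
  qed
  then have *: "((\<lambda>z. \<Sum>i\<in>{1..n}. ?g i z) has_integral
      (\<Sum>i\<in>{1..n}. integral (clients_of s f i) (F i))) {0..1}"
    by (rule has_integral_sum[OF finite_atLeastAtMost])
  show ?thesis
  proof (rule has_integral_eq[OF _ *])
    fix z :: real assume z: "z \<in> {0..1}"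
    then have "f s z \<in> {1..n}"
      using f s by (auto simp: measurable_client_mapping_def client_mapping_def)
    then show "(\<Sum>i\<in>{1..n}. ?g i z) = F (f s z) z"
      using z by (simp add: clients_of_def sum.delta)
  qed
qed

lemma has_integral_load_weighted:
  assumes f: "measurable_client_mapping n f" and s: "s \<in> location_vectors n"
  shows "((\<lambda>z. c (f s z)) has_integral (\<Sum>i\<in>{1..n}. c i * load s f i)) {0..1}"
  using has_integral_over_clients[OF f s, of "\<lambda>i _. c i"] integral_const_clients_of[OF f s]
  by simp

text \<open>The constant 1 is integrated in two ways.\<close>

lemma sum_load:
  assumes "measurable_client_mapping n f" "s \<in> location_vectors n"
  shows "(\<Sum>i\<in>{1..n}. load s f i) = 1"
proof -
  have "((\<lambda>_. 1) has_integral (\<Sum>i\<in>{1..n}. load s f i)) {0..1::real}"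
    using has_integral_load_weighted[OF assms, of "\<lambda>_. 1"] by simp
  moreover have "((\<lambda>_. 1) has_integral (1::real)) {0..1::real}"
    using has_integral_const_real[of "1::real" 0 1] by simp
  ultimately show ?thesis
    by (rule has_integral_unique)
qed

lemma load_nonneg: "0 \<le> load s f i"
  by (simp add: load_def)

lemma integrable_client_distance:
  assumes "measurable_client_mapping n f" "s \<in> location_vectors n"
  shows "(\<lambda>z. \<bar>s (f s z) - z\<bar>) integrable_on {0..1}"
proof -
  have "continuous_on {0..1} (\<lambda>z. \<bar>s i - z\<bar>)" for i
    by (intro continuous_intros)
  then show ?thesis
    using has_integral_over_clients[OF assms, of "\<lambda>i z. \<bar>s i - z\<bar>"] by blast
qed

text \<open>The squares arise because each facility's load is paid by a set of clients whose measure
  is that same load.\<close>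

lemma client_cost_has_integral:
  assumes f: "measurable_client_mapping n f" and s: "s \<in> location_vectors n"
  shows "(client_cost \<alpha> s f has_integral
    (1 - \<alpha>) * integral {0..1} (\<lambda>z. \<bar>s (f s z) - z\<bar>) + \<alpha> * (\<Sum>i\<in>{1..n}. (load s f i)\<^sup>2)) {0..1}"
proof -
  have "((\<lambda>z. load s f (f s z)) has_integral (\<Sum>i\<in>{1..n}. (load s f i)\<^sup>2)) {0..1}"
    using has_integral_load_weighted[OF f s, of "load s f"] by (simp add: power2_eq_square)
  with integrable_integral[OF integrable_client_distance[OF f s]] show ?thesis
    unfolding client_cost_def by (intro has_integral_add has_integral_mult_right)
qed

section \<open>Lower bound on the social optimum\<close>

lemma has_integral_abs_diff_midpoint:
  fixes p h :: real
  assumes "0 \<le> h"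
  shows "((\<lambda>z. \<bar>p - z\<bar>) has_integral h\<^sup>2) {p - h..p + h}"
proof -
  \<comment> \<open>Cutting at \<open>p\<close> removes the absolute value and leaves two triangles
    of area h^2/2 each.\<close>
  have "((\<lambda>z. p - z) has_integral (- (p - p)\<^sup>2 / 2) - (- (p - (p - h))\<^sup>2 / 2)) {p - h..p}"
    by (rule fundamental_theorem_of_calculus)
      (use assms in \<open>auto intro!: derivative_eq_intros
        simp: has_real_derivative_iff_has_vector_derivative[symmetric] field_simps\<close>)
  then have 1: "((\<lambda>z. \<bar>p - z\<bar>) has_integral h\<^sup>2 / 2) {p - h..p}"
    by (intro has_integral_eq[of _ "\<lambda>z. p - z" "\<lambda>z. \<bar>p - z\<bar>"]) auto
  have "((\<lambda>z. z - p) has_integral ((p + h) - p)\<^sup>2 / 2 - (p - p)\<^sup>2 / 2) {p..p + h}"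
    by (rule fundamental_theorem_of_calculus)
      (use assms in \<open>auto intro!: derivative_eq_intros
        simp: has_real_derivative_iff_has_vector_derivative[symmetric]\<close>)
  then have 2: "((\<lambda>z. \<bar>p - z\<bar>) has_integral h\<^sup>2 / 2) {p..p + h}"
    by (intro has_integral_eq[of _ "\<lambda>z. z - p" "\<lambda>z. \<bar>p - z\<bar>"]) auto
  show ?thesis
    using has_integral_combine[OF _ _ 1 2] assms by simp
qed

text \<open>The whole tent has area r^2. It is nonnegative, so cutting it down to the unit interval
  can only lose area, wherever the peak \<open>p\<close> lies.\<close>

lemma integral_tent_le:
  fixes p r :: real
  assumes "0 \<le> r"
  shows "integral {0..1} (\<lambda>z. max 0 (r - \<bar>p - z\<bar>)) \<le> r\<^sup>2"
proof -
  have "((\<lambda>z. r) has_integral (2 * r) * r) {p - r..p + r}"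
    using has_integral_const_real[of r "p - r" "p + r"] assms by simp
  from has_integral_diff[OF this has_integral_abs_diff_midpoint[OF assms]]
  have "((\<lambda>z. r - \<bar>p - z\<bar>) has_integral r\<^sup>2) {p - r..p + r}"
    by (simp add: power2_eq_square)
  then have "((\<lambda>z. max 0 (r - \<bar>p - z\<bar>)) has_integral r\<^sup>2) {p - r..p + r}"
    by (rule has_integral_eq[rotated]) auto
  then have "((\<lambda>z. max 0 (r - \<bar>p - z\<bar>)) has_integral r\<^sup>2) UNIV"
    by (rule has_integral_on_superset) auto
  moreover have "(\<lambda>z. max 0 (r - \<bar>p - z\<bar>)) integrable_on {0..1}"
    by (intro integrable_continuous_real continuous_intros)
  ultimately show ?thesis
    by (intro has_integral_subset_le[of "{0..1}" UNIV]) auto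
qed

lemma integral_client_distance_ge:
  assumes f: "measurable_client_mapping n f" and s: "s \<in> location_vectors n" and n: "n \<ge> 1"
  shows "1 / (4 * real n) \<le> integral {0..1} (\<lambda>z. \<bar>s (f s z) - z\<bar>)"
proof -
  \<comment> \<open>This radius maximises r - n r^2, the bound obtained for a general
    \<open>r\<close>.\<close>
  define r where "r = 1 / (2 * real n)"
  have r: "0 \<le> r" by (simp add: r_def)
  let ?t = "\<lambda>i z. max 0 (r - \<bar>s i - z\<bar>)"
  have t: "(\<lambda>z. ?t i z) integrable_on {0..1}" for i
    by (intro integrable_continuous_real continuous_intros)
  have "((\<lambda>z. r - (\<Sum>i\<in>{1..n}. ?t i z)) has_integral
      r - (\<Sum>i\<in>{1..n}. integral {0..1} (?t i))) {0..1}"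
    using has_integral_const_real[of r 0 1]
    by (intro has_integral_diff has_integral_sum integrable_integral t) auto
  moreover have "r - (\<Sum>i\<in>{1..n}. ?t i z) \<le> \<bar>s (f s z) - z\<bar>" if z: "z \<in> {0..1}" for z
  proof -
    have "f s z \<in> {1..n}"
      using f s z by (auto simp: measurable_client_mapping_def client_mapping_def)
    \<comment> \<open>The tent of the client's own facility is one of the nonnegative summands, and
      it alone is at least \<open>r\<close> minus the distance.\<close>
    then have "?t (f s z) z \<le> (\<Sum>i\<in>{1..n}. ?t i z)"
      by (intro member_le_sum) auto
    then show ?thesis by linarith
  qed
  ultimately have "r - (\<Sum>i\<in>{1..n}. integral {0..1} (?t i))
      \<le> integral {0..1} (\<lambda>z. \<bar>s (f s z) - z\<bar>)"
    by (rule has_integral_le[OF _ integrable_integral[OF integrable_client_distance[OF f s]]])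
  moreover have "(\<Sum>i\<in>{1..n}. integral {0..1} (?t i)) \<le> real n * r\<^sup>2"
    using sum_bounded_above[of "{1..n}" "\<lambda>i. integral {0..1} (?t i)" "r\<^sup>2"]
      integral_tent_le[OF r] by simp
  moreover have "r - real n * r\<^sup>2 = 1 / (4 * real n)"
    using n by (simp add: r_def field_simps power2_eq_square)
  ultimately show ?thesis by linarith
qed

lemma sum_load_squares_ge:
  assumes f: "measurable_client_mapping n f" and s: "s \<in> location_vectors n" and n: "n \<ge> 1"
  shows "1 / real n \<le> (\<Sum>i\<in>{1..n}. (load s f i)\<^sup>2)"
proof -
  \<comment> \<open>The square lies above its tangent line at 1/n, the equal share. Summing the
    tangents leaves only the total load, which is 1.\<close>
  have "(\<Sum>i\<in>{1..n}. 2 / real n * load s f i - (1 / real n)\<^sup>2) \<le> (\<Sum>i\<in>{1..n}. (load s f i)\<^sup>2)"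
  proof (rule sum_mono)
    fix i
    show "2 / real n * load s f i - (1 / real n)\<^sup>2 \<le> (load s f i)\<^sup>2"
      using zero_le_power2[of "load s f i - 1 / real n"]
      by (simp add: power2_diff algebra_simps)
  qed
  moreover have "(\<Sum>i\<in>{1..n}. 2 / real n * load s f i - (1 / real n)\<^sup>2)
      = 2 / real n * (\<Sum>i\<in>{1..n}. load s f i) - real n * (1 / real n)\<^sup>2"
    by (simp only: sum_subtractf sum_distrib_left[symmetric] sum_constant card_atLeastAtMost) simp
  moreover have "\<dots> = 1 / real n"
    using n unfolding sum_load[OF f s] by (simp add: power2_eq_square)
  ultimately show ?thesis by simp
qed

lemma social_cost_ge:
  assumes f: "measurable_client_mapping n f" and s: "s \<in> location_vectors n" and n: "n \<ge> 1"
    and \<alpha>: "\<alpha> \<in> {0..1}"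
  shows "(1 + 3 * \<alpha>) / (4 * real n) \<le> social_cost \<alpha> s f"
proof -
  have "(1 + 3 * \<alpha>) / (4 * real n) = (1 - \<alpha>) * (1 / (4 * real n)) + \<alpha> * (1 / real n)"
    using n by (simp add: field_simps)
  also have "\<dots> \<le> (1 - \<alpha>) * integral {0..1} (\<lambda>z. \<bar>s (f s z) - z\<bar>) + \<alpha> * (\<Sum>i\<in>{1..n}. (load s f i)\<^sup>2)"
    using integral_client_distance_ge[OF f s n] sum_load_squares_ge[OF f s n] \<alpha>
    by (intro add_mono mult_left_mono) auto
  also have "\<dots> = social_cost \<alpha> s f"
    unfolding social_cost_def by (rule integral_unique[OF client_cost_has_integral[OF f s], symmetric])
  finally show ?thesis .
qed

lemma social_opt_ge:
  assumes f: "measurable_client_mapping n f" and s: "s \<in> location_vectors n" and n: "n \<ge> 1"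
    and \<alpha>: "\<alpha> \<in> {0..1}"
  shows "(1 + 3 * \<alpha>) / (4 * real n) \<le> social_opt \<alpha> n"
  unfolding social_opt_def
  \<comment> \<open>The given \<open>s\<close> and \<open>f\<close> witness that the set under the
    infimum is nonempty.\<close>
  by (rule cInf_greatest) (use f s social_cost_ge[OF _ _ n \<alpha>] in auto)

section \<open>Upper bound on the social cost of an equilibrium\<close>

lemma equilibrium_social_cost_le:
  assumes f: "measurable_client_mapping n f" and s: "s \<in> location_vectors n"
    and eq: "client_equilibrium \<alpha> n s f" and \<alpha>: "\<alpha> \<in> {0..1}" and k: "k \<ge> 1"
    and j: "inj_on j {1..k}" "j ` {1..k} \<subseteq> {1..n}"
    and sj: "\<And>m. m \<in> {1..k} \<Longrightarrow> s (j m) = (2 * real m - 1) / (2 * real k)"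
  shows "social_cost \<alpha> s f \<le> (1 + 3 * \<alpha>) / (4 * real k)"
proof -
  let ?C = "client_cost \<alpha> s f"
  \<comment> \<open>Half the length of one of the \<open>k\<close> equal cells of the unit
    interval.\<close>
  define h where "h = 1 / (2 * real k)"
  have h: "0 \<le> h" by (simp add: h_def)
  have C: "?C integrable_on {0..1}"
    using client_cost_has_integral[OF f s] by blast
  \<comment> \<open>Cells are counted from 0 and facilities from 1, so \<open>j (Suc m)\<close> is
    the facility at the midpoint of cell \<open>m\<close>; the equilibrium condition bounds each
    client's cost there by that of choosing it.\<close>
  have piece: "integral {real m / real k..real (Suc m) / real k} ?C
      \<le> (1 - \<alpha>) * h\<^sup>2 + \<alpha> * load s f (j (Suc m)) / real k" if m: "m < k" for m
  proof -
    let ?I = "{real m / real k..real (Suc m) / real k}"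
    let ?p = "s (j (Suc m))"
    have p: "?p = (2 * real (Suc m) - 1) / (2 * real k)" using sj[of "Suc m"] m by simp
    have I: "?I = {?p - h..?p + h}"
      using k by (simp add: p h_def field_simps)
    have "real (Suc m) / real k \<le> 1"
      using m by simp
    then have sub: "?I \<subseteq> {0..1}"
      by (simp add: atLeastatMost_subset_iff)
    have "((\<lambda>z. \<alpha> * load s f (j (Suc m))) has_integral \<alpha> * load s f (j (Suc m)) / real k) ?I"
      using has_integral_const_real[of "\<alpha> * load s f (j (Suc m))" "real m / real k" "real (Suc m) / real k"] k
      by (simp add: field_simps)
    then have "((\<lambda>z. (1 - \<alpha>) * \<bar>?p - z\<bar> + \<alpha> * load s f (j (Suc m))) has_integral
        (1 - \<alpha>) * h\<^sup>2 + \<alpha> * load s f (j (Suc m)) / real k) ?I"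
      using has_integral_abs_diff_midpoint[OF h, of ?p]
      by (intro has_integral_add has_integral_mult_right) (simp_all only: I)
    moreover have "(?C has_integral integral ?I ?C) ?I"
      using integrable_on_subinterval[OF C sub] by (rule integrable_integral)
    moreover have "?C z \<le> (1 - \<alpha>) * \<bar>?p - z\<bar> + \<alpha> * load s f (j (Suc m))" if "z \<in> ?I" for z
    proof -
      have "j (Suc m) \<in> {1..n}" using j(2) m by (simp add: image_subset_iff)
      then show ?thesis
        using eq subsetD[OF sub that] unfolding client_equilibrium_def by blast
    qed
    ultimately show ?thesis
      using has_integral_le by blast
  qed
  have prefix: "integral {0..real m / real k} ?C
      \<le> (\<Sum>i<m. (1 - \<alpha>) * h\<^sup>2 + \<alpha> * load s f (j (Suc i)) / real k)" if "m \<le> k" for m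
    using that
  proof (induction m)
    case 0
    then show ?case by simp
  next
    case (Suc m)
    have "real (Suc m) / real k \<le> 1"
      using Suc.prems by simp
    then have "?C integrable_on {0..real (Suc m) / real k}"
      by (intro integrable_on_subinterval[OF C]) (simp add: atLeastatMost_subset_iff)
    then have "integral {0..real (Suc m) / real k} ?C
        = integral {0..real m / real k} ?C + integral {real m / real k..real (Suc m) / real k} ?C"
      by (intro Henstock_Kurzweil_Integration.integral_combine[symmetric]) (auto simp: divide_right_mono)
    then show ?case
      using Suc.IH Suc.prems piece[of m] by simp
  qed
  \<comment> \<open>Injectivity of \<open>j\<close> ensures that no load is counted twice, so the
    total load bounds this sum.\<close>
  have "(\<Sum>i<k. load s f (j (Suc i))) = (\<Sum>m\<in>{1..k}. load s f (j m))"
    by (rule sum.reindex_bij_witness[of _ "\<lambda>m. m - 1" Suc]) auto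
  also have "\<dots> = (\<Sum>i\<in>j ` {1..k}. load s f i)"
    by (simp add: sum.reindex[OF j(1)] comp_def del: One_nat_def)
  also have "\<dots> \<le> (\<Sum>i\<in>{1..n}. load s f i)"
    by (intro sum_mono2 j(2) load_nonneg) auto
  also have "\<dots> = 1" by (rule sum_load[OF f s])
  finally have loads: "(\<Sum>i<k. load s f (j (Suc i))) \<le> 1" .
  have "social_cost \<alpha> s f \<le> (\<Sum>i<k. (1 - \<alpha>) * h\<^sup>2 + \<alpha> * load s f (j (Suc i)) / real k)"
    using prefix[of k] k by (simp add: social_cost_def)
  also have "\<dots> = real k * ((1 - \<alpha>) * h\<^sup>2) + \<alpha> / real k * (\<Sum>i<k. load s f (j (Suc i)))"
    by (simp add: sum.distrib sum_distrib_left)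
  also have "\<dots> \<le> real k * ((1 - \<alpha>) * h\<^sup>2) + \<alpha> / real k * 1"
    using loads \<alpha> by (intro add_left_mono mult_left_mono) auto
  also have "\<dots> = (1 + 3 * \<alpha>) / (4 * real k)"
    using k by (simp add: h_def field_simps power2_eq_square)
  finally show ?thesis .
qed

section \<open>Paired locations and the quality bound\<close>

theorem theorem8:
  fixes \<alpha> :: real and n k :: nat and s s_pair :: "nat \<Rightarrow> real"
    and f :: "(nat \<Rightarrow> real) \<Rightarrow> real \<Rightarrow> nat"
  assumes "\<alpha> \<in> {0..1}"
    and "k \<ge> 1" and "n = 2 * k - 1"
    and "\<And>i. i \<in> {1..k} \<Longrightarrow> s (2 * i - 1) = (2 * real i - 1) / (2 * real k)"
    and "\<And>i. i \<in> {1..k} \<Longrightarrow> s (2 * i) = (2 * real i - 1) / (2 * real k)"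
    and "s_pair = omit_entry n (k + 1) s"
    and "measurable_client_mapping n f"
    and "induced_client_equilibrium \<alpha> n s_pair f"
  shows "quality \<alpha> n s_pair f
    \<le> 8 * (1 + \<alpha>) * (real n)\<^sup>2 / ((1 + 3 * \<alpha>) * (1 + real n)\<^sup>2)"
proof -
  note \<alpha> = assms(1) and k = assms(2) and n = assms(3) and f = assms(7)
  have n1: "n \<ge> 1" using k n by simp
  have rn: "real n = 2 * real k - 1" using k n by (simp add: of_nat_diff)
  \<comment> \<open>The range reaches 2k = n + 1 because \<open>omit_entry\<close> reads one index
    further beyond the gap.\<close>
  have s01: "s i \<in> {0..1}" if i: "i \<in> {1..2 * k}" for i
  proof -
    obtain m where m: "m \<in> {1..k}" "i = 2 * m \<or> i = 2 * m - 1"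
    proof (cases "even i")
      case True
      then show ?thesis using i that[of "i div 2"] by auto
    next
      case False
      then show ?thesis using i that[of "(i + 1) div 2"] by (auto elim!: oddE)
    qed
    then have "s i = (2 * real m - 1) / (2 * real k)" using assms(4,5) by blast
    then show ?thesis using m(1) by auto
  qed
  have s: "s_pair \<in> location_vectors n"
    unfolding location_vectors_def assms(6) omit_entry_def
    using s01 n by (intro restrict_PiE_iff[THEN iffD2] ballI) auto
  \<comment> \<open>Before the gap this is entry 2m - 1 of \<open>s\<close>; after it, the shift
    reads entry 2m, its co-located partner. So the odd positions still run through all
    \<open>k\<close> midpoints.\<close>
  have s_odd: "s_pair (2 * m - 1) = (2 * real m - 1) / (2 * real k)" if m: "m \<in> {1..k}" for m
    using assms(4)[OF m] assms(5)[OF m] m n by (auto simp: assms(6) omit_entry_def)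
  have "client_equilibrium \<alpha> n s_pair f"
    using assms(8) by (simp add: induced_client_equilibrium_def)
  then have SC: "social_cost \<alpha> s_pair f \<le> (1 + 3 * \<alpha>) / (4 * real k)"
    using n by (intro equilibrium_social_cost_le[OF f s _ \<alpha> k, of "\<lambda>m. 2 * m - 1"] s_odd)
      (auto simp: inj_on_def)
  have pos: "0 < (1 + 3 * \<alpha>) / (4 * real n)" using \<alpha> n1 by simp
  have "quality \<alpha> n s_pair f \<le> ((1 + 3 * \<alpha>) / (4 * real k)) / ((1 + 3 * \<alpha>) / (4 * real n))"
    unfolding quality_def using SC social_opt_ge[OF f s n1 \<alpha>] pos \<alpha> by (intro frac_le) auto
  also have "\<dots> = real n / real k"
  proof -
    have "1 + 3 * \<alpha> \<noteq> 0" using \<alpha> by auto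
    then show ?thesis by simp
  qed
  \<comment> \<open>Since 1 + n = 2k, expanding the fraction produces the target
    denominator.\<close>
  also have "\<dots> = 4 * real n * ((1 + 3 * \<alpha>) * real k) / ((1 + 3 * \<alpha>) * (1 + real n)\<^sup>2)"
  proof -
    have "1 + 3 * \<alpha> \<noteq> 0" using \<alpha> by auto
    then show ?thesis using k by (simp add: rn power2_eq_square divide_simps)
  qed
  also have "\<dots> \<le> 4 * real n * (2 * (1 + \<alpha>) * real n) / ((1 + 3 * \<alpha>) * (1 + real n)\<^sup>2)"
  proof -
    \<comment> \<open>With n = 2k - 1, this expression is exactly 2(1 + \<alpha>)n - (1 +
      3\<alpha>)k.\<close>
    have "0 \<le> (real k - 1) * (3 + \<alpha>) + (1 - \<alpha>)" using \<alpha> k by simp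
    then have "(1 + 3 * \<alpha>) * real k \<le> 2 * (1 + \<alpha>) * real n"
      unfolding rn by (simp add: algebra_simps)
    then show ?thesis
      using \<alpha> by (intro divide_right_mono mult_left_mono) auto
  qed
  also have "\<dots> = 8 * (1 + \<alpha>) * (real n)\<^sup>2 / ((1 + 3 * \<alpha>) * (1 + real n)\<^sup>2)"
    by (simp add: power2_eq_square mult.assoc mult.left_commute)
  finally show ?thesis .
qed

end
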